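(* Let $X$ be a complex Banach space and let $T\in\mathcal{B}(X)$ be a supercyclic operator. Then $$\sigma_{rgD}(T)=\sigma_{gK}(T).$$
   Context: $\mathcal{B}(X)$ is the algebra of bounded linear operators on $X$; $N(T)$, $R(T)$ are the null space and range, and $R^{\infty}(T)=\bigcap_{n\ge 0}R(T^n)$. $T$ is supercyclic if there is $x\in X$ such that $\{\lambda T^n x:\lambda\in\mathbb{C},\ n=0,1,2,\dots\}$ is dense in $X$. $T$ is semi-regular (Kato) if $R(T)$ is closed and $N(T)\subseteq R^\infty(T)$. $T$ is Pseudo-Fredholm (admits a generalized Kato decomposition) if there are $T$-invariant closed subspaces $M,N$ with $X=M\oplus N$, $T|_M$ semi-regular and $T|_N$ quasinilpotent (here $M=\{0\}$ or $N=\{0\}$ is allowed). $\sigma_{gK}(T)=\{\lambda\in\mathbb{C}: T-\lambda I \text{ is not Pseudo-Fredholm}\}$. $H_0(T)=\{x\in X:\lim_{n}\|T^nx\|^{1/n}=0\}$ is the quasinilpotent part of $T$. $K(T)$ is the analytic core: the set of $x\in X$ for which there exist $c>0$ and a sequence $(x_n)_{n\ge0}$ in $X$ with $x_0=x$, $Tx_{n+1}=x_n$ and $\|x_n\|\le c^n\|x\|$ for all $n$. $T$ is right generalized Drazin invertible if $K(T)$ is closed and there is a closed $T$-invariant subspace $N$ with $X=K(T)\oplus N$ and $N\subseteq H_0(T)$. $\sigma_{rgD}(T)=\{\lambda\in\mathbb{C}:T-\lambda I\text{ is not right generalized Drazin invertible}\}$. *)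

theory Defs
  imports "HOL-Analysis.Analysis"
begin

text \<open>HOL-Analysis only provides real Banach spaces.  The norm is homogeneous with respect to
  complex scalars, and the real scalar multiplication is the restriction of the complex one.\<close>

class complex_banach = banach +
  fixes scaleC :: "complex \<Rightarrow> 'a \<Rightarrow> 'a"  (infixr \<open>*\<^sub>C\<close> 75)
  assumes scaleC_add_right: "a *\<^sub>C (x + y) = a *\<^sub>C x + a *\<^sub>C y"
    and scaleC_add_left: "(a + b) *\<^sub>C x = a *\<^sub>C x + b *\<^sub>C x"
    and scaleC_scaleC: "a *\<^sub>C b *\<^sub>C x = (a * b) *\<^sub>C x"
    and scaleC_of_real: "complex_of_real r *\<^sub>C x = r *\<^sub>R x"
    and norm_scaleC: "norm (a *\<^sub>C x) = cmod a * norm x"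

lemma vector_space_scaleC:
  "vector_space (scaleC :: complex \<Rightarrow> 'a::complex_banach \<Rightarrow> 'a)"
  by standard
    (use scaleC_of_real[of 1] in
      \<open>auto simp: scaleC_add_right scaleC_add_left scaleC_scaleC\<close>)

instantiation complex :: complex_banach
begin

definition scaleC_complex :: "complex \<Rightarrow> complex \<Rightarrow> complex" where
  "scaleC_complex = (*)"

instance
  by standard (auto simp: scaleC_complex_def algebra_simps norm_mult scaleR_conv_of_real)

end

definition bounded_clinear :: "('a::complex_banach \<Rightarrow> 'a) \<Rightarrow> bool" where
  "bounded_clinear T \<longleftrightarrow> bounded_linear T \<and> (\<forall>c x. T (c *\<^sub>C x) = c *\<^sub>C T x)"

definition supercyclic :: "('a::complex_banach \<Rightarrow> 'a) \<Rightarrow> bool" where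
  "supercyclic T \<longleftrightarrow> (\<exists>x. closure {c *\<^sub>C (T ^^ n) x |c n. True} = UNIV)"

definition closed_invariant_subspace :: "('a::complex_banach \<Rightarrow> 'a) \<Rightarrow> 'a set \<Rightarrow> bool" where
  "closed_invariant_subspace T M \<longleftrightarrow>
     module.subspace scaleC M \<and> closed M \<and> T ` M \<subseteq> M"

definition direct_sum_decomp :: "'a::complex_banach set \<Rightarrow> 'a set \<Rightarrow> bool" where
  "direct_sum_decomp M N \<longleftrightarrow> {x + y |x y. x \<in> M \<and> y \<in> N} = UNIV \<and> M \<inter> N = {0}"

text \<open>Properties of the restriction of \<open>T\<close> to a closed \<open>T\<close>-invariant subspace \<open>M\<close> are
  written relative to \<open>M\<close>; since \<open>M\<close> is closed, a subset of \<open>M\<close> is closed in \<open>M\<close> iff it is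
  closed in the whole space.\<close>

definition null_space_on :: "'a set \<Rightarrow> ('a::complex_banach \<Rightarrow> 'a) \<Rightarrow> 'a set" where
  "null_space_on M T = {x \<in> M. T x = 0}"

definition hyper_range_on :: "'a set \<Rightarrow> ('a::complex_banach \<Rightarrow> 'a) \<Rightarrow> 'a set" where
  "hyper_range_on M T = (\<Inter>n. (T ^^ n) ` M)"

definition semi_regular_on :: "'a set \<Rightarrow> ('a::complex_banach \<Rightarrow> 'a) \<Rightarrow> bool" where
  "semi_regular_on M T \<longleftrightarrow> closed (T ` M) \<and> null_space_on M T \<subseteq> hyper_range_on M T"

text \<open>The operator norm of a restriction, in the form of \<^const>\<open>onorm\<close>.  A bounded operator is
  quasinilpotent if its spectral radius, given by Gelfand's limit, is zero; on the zero space
  every operator is quasinilpotent.\<close>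

definition onorm_on :: "'a set \<Rightarrow> ('a::complex_banach \<Rightarrow> 'a) \<Rightarrow> real" where
  "onorm_on N T = (SUP x\<in>N. norm (T x) / norm x)"

definition quasinilpotent_on :: "'a set \<Rightarrow> ('a::complex_banach \<Rightarrow> 'a) \<Rightarrow> bool" where
  "quasinilpotent_on N T \<longleftrightarrow> (\<lambda>n. root n (onorm_on N (T ^^ n))) \<longlonglongrightarrow> 0"

definition pseudo_Fredholm :: "('a::complex_banach \<Rightarrow> 'a) \<Rightarrow> bool" where
  "pseudo_Fredholm T \<longleftrightarrow>
     (\<exists>M N. closed_invariant_subspace T M \<and> closed_invariant_subspace T N \<and>
            direct_sum_decomp M N \<and> semi_regular_on M T \<and> quasinilpotent_on N T)"

definition quasinilpotent_part :: "('a::complex_banach \<Rightarrow> 'a) \<Rightarrow> 'a set" where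
  "quasinilpotent_part T = {x. (\<lambda>n. root n (norm ((T ^^ n) x))) \<longlonglongrightarrow> 0}"

definition analytic_core :: "('a::complex_banach \<Rightarrow> 'a) \<Rightarrow> 'a set" where
  "analytic_core T =
     {x. \<exists>c>0. \<exists>u. u 0 = x \<and> (\<forall>n. T (u (Suc n)) = u n) \<and> (\<forall>n. norm (u n) \<le> c ^ n * norm x)}"

definition right_gen_Drazin_invertible :: "('a::complex_banach \<Rightarrow> 'a) \<Rightarrow> bool" where
  "right_gen_Drazin_invertible T \<longleftrightarrow>
     closed (analytic_core T) \<and>
     (\<exists>N. closed_invariant_subspace T N \<and> direct_sum_decomp (analytic_core T) N \<and>
          N \<subseteq> quasinilpotent_part T)"

definition shift_op :: "('a::complex_banach \<Rightarrow> 'a) \<Rightarrow> complex \<Rightarrow> 'a \<Rightarrow> 'a" where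
  "shift_op T c = (\<lambda>x. T x - c *\<^sub>C x)"

definition gK_spectrum :: "('a::complex_banach \<Rightarrow> 'a) \<Rightarrow> complex set" where
  "gK_spectrum T = {c. \<not> pseudo_Fredholm (shift_op T c)}"

definition rgD_spectrum :: "('a::complex_banach \<Rightarrow> 'a) \<Rightarrow> complex set" where
  "rgD_spectrum T = {c. \<not> right_gen_Drazin_invertible (shift_op T c)}"

end

theory Submission
  imports Defs
begin

text \<open>Write \<open>S = T - c\<close>.  The claim is that \<open>S\<close> is right generalized Drazin invertible iff it is
  pseudo-Fredholm, for every complex \<open>c\<close>.

  If \<open>X = K(S) \<oplus> N\<close> with \<open>K(S)\<close> closed and \<open>N \<subseteq> H\<^sub>0(S)\<close>, then \<open>S\<close> maps \<open>K(S)\<close> onto itself, hence is semi-regular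
  there, and the uniform boundedness principle on \<open>N\<close> turns the pointwise condition \<open>N \<subseteq> H\<^sub>0(S)\<close> into
  quasinilpotence (\<open>quasinilpotent_on_if_subset_quasinilpotent_part\<close>).

  Conversely, let \<open>X = M \<oplus> N\<close> with \<open>S\<close> semi-regular on \<open>M\<close> and quasinilpotent on \<open>N\<close>.  If \<open>S\<close> maps \<open>M\<close> onto \<open>M\<close>,
  then \<open>K(S) = M\<close> (\<open>analytic_core_eq_if_direct_sum\<close>) and \<open>N \<subseteq> H\<^sub>0(S)\<close>, and the decomposition is the required one.
  That \<open>S\<close> is onto on \<open>M\<close> is where supercyclicity enters (\<open>semi_regular_summand_onto_if_supercyclic\<close>).
  Otherwise \<open>c\<close> is an eigenvalue of the adjoint of \<open>T\<close> restricted to \<open>M\<close>, and semi-regularity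
  lengthens the eigenvector to a Jordan chain of length two.  In terms of
  subspaces, with no functionals: \<open>S M + N\<close> and \<open>S\<^sup>2 M + N\<close> are closed, and in the quotient by the second
  one a supercyclic vector \<open>x\<close> and \<open>S x\<close> span a Jordan block of size two.  But the orbit of a cyclic vector
  of such a block is, up to scalars, the set of vectors \<open>x + (k / c) S x\<close> for natural \<open>k\<close>
  (or just \<open>x\<close>, \<open>S x\<close> and \<open>0\<close>, if \<open>c = 0\<close>), and its multiples are not dense
  (\<open>supercyclic_vector_modulo_jordan_flag\<close>).\<close>

section \<open>Consequences of the Baire category theorem on closed subspaces\<close>

text \<open>A closed subspace of a Banach space is a barrelled space.  By Baire some multiple of \<open>F\<close>
  contains a ball of \<open>U\<close> around a point \<open>x\<close>, and symmetry and convexity move that ball to the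
  origin: \<open>z\<close> is the midpoint of \<open>z + x\<close> and \<open>z - x\<close>.  Both the uniform boundedness principle and
  the open mapping theorem below are instances.\<close>
lemma absorbing_barrel_neighbourhood:
  fixes U F :: "'a::banach set"
  assumes U: "subspace U" "closed U"
    and F: "closed F" "convex F" "F \<subseteq> U"
    and sym: "\<And>x. x \<in> F \<Longrightarrow> - x \<in> F"
    and absorb: "\<And>x. x \<in> U \<Longrightarrow> \<exists>n::nat. x \<in> (*\<^sub>R) (real (Suc n)) ` F"
  shows "\<exists>r>0. \<forall>x\<in>U. norm x \<le> r \<longrightarrow> x \<in> F"
proof -
  define G where "G = (\<lambda>n::nat. (*\<^sub>R) (real (Suc n)) ` F)"
  let ?X = "top_of_set U"
  have GU: "G n \<subseteq> U" for n
    using F U(1) by (auto simp: G_def subspace_scale)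
  have clG: "closedin ?X (G n)" for n
    using F(1) GU by (auto simp: G_def intro!: closed_subset closed_scaling)
  have compl: "completely_metrizable_space ?X"
    using U(2) by (intro completely_metrizable_space_closedin completely_metrizable_space_euclidean) auto
  have "\<Union>(range G) = U"
  proof (intro equalityI subsetI)
    show "x \<in> \<Union>(range G)" if "x \<in> U" for x
      using absorb[OF that] by (simp only: G_def UN_iff UNIV_I bex_UNIV)
  qed (use GU in blast)
  moreover have "?X interior_of U \<noteq> {}"
    using subspace_0[OF U(1)] interior_of_topspace[of ?X] by auto
  ultimately have "\<exists>n. ?X interior_of (G n) \<noteq> {}"
    using Baire_category_alt[of ?X "range G"] compl clG by fastforce
  then obtain n x where x: "x \<in> ?X interior_of (G n)"
    by blast
  then obtain e where e: "e > 0" "ball x e \<inter> U \<subseteq> G n" and xU: "x \<in> U"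
    using interior_of_subset_topspace[of ?X "G n"] openin_interior_of[of ?X "G n"] interior_of_subset[of ?X "G n"]
    unfolding openin_contains_ball by (metis (no_types, lifting) Int_commute order_trans subsetD topspace_euclidean_subtopology)
  have key: "z \<in> G n" if z: "z \<in> U" "norm z < e" for z
  proof -
    have "x + z \<in> G n" "x - z \<in> G n"
      using z xU U(1) e(2) by (auto simp: subset_eq dist_norm subspace_add subspace_diff)
    then obtain a b where ab: "a \<in> F" "b \<in> F" "x + z = real (Suc n) *\<^sub>R a" "x - z = real (Suc n) *\<^sub>R b"
      by (auto simp: G_def)
    have "(1/2) *\<^sub>R a + (1/2) *\<^sub>R (- b) \<in> F"
      using F(2) ab sym by (intro convexD) auto
    moreover have "real (Suc n) *\<^sub>R ((1/2) *\<^sub>R a + (1/2) *\<^sub>R (- b)) = (1/2) *\<^sub>R ((x + z) - (x - z))"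
      unfolding ab by (simp add: algebra_simps del: of_nat_Suc)
    then have "real (Suc n) *\<^sub>R ((1/2) *\<^sub>R a + (1/2) *\<^sub>R (- b)) = z"
      by (simp add: scaleR_2[symmetric])
    ultimately show ?thesis
      unfolding G_def by (metis image_eqI)
  qed
  have "x \<in> F" if "x \<in> U" "norm x \<le> e / (2 * real (Suc n))" for x
  proof -
    have "norm (real (Suc n) *\<^sub>R x) < e"
      using that(2) e(1) by (simp add: field_simps del: of_nat_Suc)
    then have "real (Suc n) *\<^sub>R x \<in> G n"
      using key that U(1) by (simp add: subspace_scale)
    then show ?thesis
      by (auto simp: G_def simp del: of_nat_Suc)
  qed
  then show ?thesis
    using e(1) by (intro exI[of _ "e / (2 * real (Suc n))"]) auto
qed

text \<open>The barrel is the set where all the operators are bounded by one.\<close>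
lemma uniform_boundedness_on:
  fixes \<Phi> :: "nat \<Rightarrow> 'a::banach \<Rightarrow> 'b::real_normed_vector"
  assumes U: "subspace U" "closed U"
    and lin: "\<And>n. bounded_linear (\<Phi> n)"
    and bdd: "\<And>x. x \<in> U \<Longrightarrow> \<exists>B. \<forall>n. norm (\<Phi> n x) \<le> B"
  shows "\<exists>B>0. \<forall>x\<in>U. \<forall>n. norm (\<Phi> n x) \<le> B * norm x"
proof -
  define F where "F = U \<inter> (\<Inter>n. \<Phi> n -` cball 0 1)"
  have linear: "linear (\<Phi> n)" for n
    using lin by (simp add: bounded_linear.linear)
  have "closed F"
    unfolding F_def using U(2) lin
    by (intro closed_Int closed_INT ballI continuous_closed_vimage)
       (auto simp: linear_continuous_at)
  moreover have "convex F"
    unfolding F_def using U(1) linear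
    by (intro convex_Int convex_INT convex_linear_vimage) (auto simp: subspace_imp_convex)
  moreover have "\<exists>n::nat. x \<in> (*\<^sub>R) (real (Suc n)) ` F" if xU: "x \<in> U" for x
  proof -
    obtain B where B: "\<And>n. norm (\<Phi> n x) \<le> B"
      using bdd[OF xU] by blast
    obtain j :: nat where "B \<le> real j"
      using real_arch_simple by blast
    then obtain k :: nat where k: "B \<le> real (Suc k)"
      by (intro that[of j]) simp
    let ?y = "(1 / real (Suc k)) *\<^sub>R x"
    have "norm (\<Phi> n ?y) \<le> 1" for n
      using order_trans[OF B k, of n] by (simp add: linear_cmul[OF linear] del: of_nat_Suc)
    moreover have "?y \<in> U"
      using xU U(1) by (simp add: subspace_scale)
    ultimately have "?y \<in> F"
      by (simp add: F_def)
    moreover have "x = real (Suc k) *\<^sub>R ?y"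
      by simp
    ultimately show ?thesis
      by (intro exI[of _ k] image_eqI[of _ _ ?y])
  qed
  ultimately obtain r where r: "r > 0" "\<And>x. x \<in> U \<Longrightarrow> norm x \<le> r \<Longrightarrow> x \<in> F"
    using absorbing_barrel_neighbourhood[OF U, of F] U(1)
    by (auto simp: F_def subspace_neg linear_neg[OF linear])
  have "norm (\<Phi> n x) \<le> 1 / r * norm x" if "x \<in> U" for x n
  proof (cases "x = 0")
    case True
    then show ?thesis using linear_0[OF linear] by simp
  next
    case False
    have "(r / norm x) *\<^sub>R x \<in> F"
      using r that U(1) False by (simp add: subspace_scale)
    then have "norm (\<Phi> n ((r / norm x) *\<^sub>R x)) \<le> 1"
      by (auto simp: F_def)
    then show ?thesis
      using r(1) False by (simp add: linear_cmul[OF linear] field_simps)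
  qed
  then show ?thesis
    using r(1) by (intro exI[of _ "1 / r"]) auto
qed

text \<open>The barrel is the closure of the image of the unit ball, so every vector of the range
  is approximated by images of vectors of comparable norm.\<close>
lemma approximate_preimage:
  fixes f :: "'a::banach \<Rightarrow> 'b::banach"
  assumes U: "subspace U"
    and f: "bounded_linear f" and V: "closed (f ` U)"
  shows "\<exists>C>0. \<forall>y\<in>f ` U. \<exists>x\<in>U. norm x \<le> C * norm y \<and> norm (y - f x) \<le> norm y / 2"
proof -
  define B where "B = f ` (U \<inter> cball 0 1)"
  define F where "F = closure B"
  have lin: "linear f"
    using f by (simp add: bounded_linear.linear)
  have sV: "subspace (f ` U)"
    using lin U by (rule linear_subspace_image)
  have "convex B"
    unfolding B_def using lin U
    by (intro convex_linear_image convex_Int) (auto simp: subspace_imp_convex)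
  then have "convex F"
    unfolding F_def by (rule convex_closure)
  moreover have "F \<subseteq> f ` U"
    unfolding F_def using V by (intro closure_minimal) (auto simp: B_def)
  moreover have "- x \<in> F" if "x \<in> F" for x
  proof -
    have "uminus ` B \<subseteq> B"
    proof clarify
      fix x assume "x \<in> B"
      then obtain u where "u \<in> U" "norm u \<le> 1" "x = f u"
        by (auto simp: B_def)
      then show "- x \<in> B"
        unfolding B_def using U by (intro image_eqI[of _ _ "- u"]) (auto simp: linear_neg[OF lin] subspace_neg)
    qed
    then have "uminus ` B \<subseteq> closure B"
      using closure_subset by blast
    then have "uminus ` closure B \<subseteq> closure B"
      by (intro image_closure_subset) (auto intro!: continuous_intros)
    then show ?thesis
      using that unfolding F_def by blast
  qed
  moreover have "\<exists>n::nat. y \<in> (*\<^sub>R) (real (Suc n)) ` F" if "y \<in> f ` U" for y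
  proof -
    obtain x where x: "x \<in> U" "y = f x"
      using \<open>y \<in> f ` U\<close> by blast
    obtain j :: nat where "norm x \<le> real j"
      using real_arch_simple by blast
    then obtain k :: nat where k: "norm x \<le> real (Suc k)"
      by (intro that[of j]) simp
    have "(1 / real (Suc k)) *\<^sub>R x \<in> U"
      using x U by (simp add: subspace_scale)
    moreover have "norm ((1 / real (Suc k)) *\<^sub>R x) \<le> 1"
      using k by (simp del: of_nat_Suc)
    ultimately have "(1 / real (Suc k)) *\<^sub>R x \<in> U \<inter> cball 0 1"
      by simp
    then have "f ((1 / real (Suc k)) *\<^sub>R x) \<in> F"
      unfolding F_def B_def by (intro subsetD[OF closure_subset] imageI)
    moreover have "y = real (Suc k) *\<^sub>R f ((1 / real (Suc k)) *\<^sub>R x)"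
      by (simp add: x linear_cmul[OF lin] del: of_nat_Suc)
    ultimately show ?thesis
      by (intro exI[of _ k] image_eqI)
  qed
  ultimately have "\<exists>r>0. \<forall>y\<in>f ` U. norm y \<le> r \<longrightarrow> y \<in> F"
    by (intro absorbing_barrel_neighbourhood[OF sV V]) (simp_all add: F_def)
  then obtain r where r: "r > 0" "\<And>y. y \<in> f ` U \<Longrightarrow> norm y \<le> r \<Longrightarrow> y \<in> F"
    by blast
  have "\<exists>x\<in>U. norm x \<le> 1 / r * norm y \<and> norm (y - f x) \<le> norm y / 2" if y: "y \<in> f ` U" for y
  proof (cases "y = 0")
    case True
    then show ?thesis
      using subspace_0[OF U] linear_0[OF lin] by (intro bexI[of _ 0]) auto
  next
    case False
    define t where "t = norm y / r"
    have t: "t > 0" using False r(1) by (simp add: t_def)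
    have "(1 / t) *\<^sub>R y \<in> F"
      using r y sV False by (simp add: subspace_scale t_def)
    then obtain b where b: "b \<in> B" "dist b ((1 / t) *\<^sub>R y) < r / 2"
      unfolding F_def closure_approachable using r(1) by (metis half_gt_zero)
    then obtain u where u: "u \<in> U" "norm u \<le> 1" "b = f u"
      by (auto simp: B_def)
    have "y - f (t *\<^sub>R u) = t *\<^sub>R ((1 / t) *\<^sub>R y - b)"
      using t by (simp add: u linear_cmul[OF lin] algebra_simps)
    then have "norm (y - f (t *\<^sub>R u)) = t * dist b ((1 / t) *\<^sub>R y)"
      using t by (simp add: dist_norm norm_minus_commute)
    also have "\<dots> \<le> t * (r / 2)"
      using t b(2) by (intro mult_left_mono) auto
    also have "\<dots> = norm y / 2"
      using r(1) by (simp add: t_def)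
    finally have "norm (y - f (t *\<^sub>R u)) \<le> norm y / 2" .
    moreover have "norm (t *\<^sub>R u) \<le> 1 / r * norm y"
      using mult_left_mono[OF u(2), of t] t r(1) by (simp add: t_def)
    ultimately show ?thesis
      using u(1) U by (metis subspace_scale)
  qed
  then show ?thesis
    using r(1) by (intro exI[of _ "1 / r"]) auto
qed

text \<open>The open mapping theorem in quantitative form, for the restriction of \<open>f\<close> to a closed subspace
  on which it has closed range: approximate preimages of the successive remainders
  have geometrically decreasing norms, and they add up to an exact preimage.\<close>
lemma bounded_preimages:
  fixes f :: "'a::banach \<Rightarrow> 'b::banach"
  assumes U: "subspace U" "closed U"
    and f: "bounded_linear f" and V: "closed (f ` U)"
  shows "\<exists>C>0. \<forall>y\<in>f ` U. \<exists>x\<in>U. f x = y \<and> norm x \<le> C * norm y"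
proof -
  have lin: "linear f"
    using f by (simp add: bounded_linear.linear)
  have sV: "subspace (f ` U)"
    using lin U(1) by (rule linear_subspace_image)
  obtain C g where C: "C > 0"
    and g: "\<And>y. y \<in> f ` U \<Longrightarrow> g y \<in> U" "\<And>y. y \<in> f ` U \<Longrightarrow> norm (g y) \<le> C * norm y"
      "\<And>y. y \<in> f ` U \<Longrightarrow> norm (y - f (g y)) \<le> norm y / 2"
    using approximate_preimage[OF U(1) f V] by metis
  have "\<exists>x\<in>U. f x = y \<and> norm x \<le> 2 * C * norm y" if y: "y \<in> f ` U" for y
  proof -
    define w where "w = (\<lambda>n. ((\<lambda>z. z - f (g z)) ^^ n) y)"
    have w0: "w 0 = y" and wS: "w (Suc n) = w n - f (g (w n))" for n
      by (simp_all add: w_def)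
    have wV: "w n \<in> f ` U" for n
      by (induction n) (use y g(1) sV in \<open>auto simp: w0 wS subspace_diff\<close>)
    have wn: "norm (w n) \<le> norm y * (1/2) ^ n" for n
    proof (induction n)
      case (Suc n)
      have "norm (w (Suc n)) \<le> norm (w n) / 2"
        using g(3)[OF wV] by (simp add: wS)
      then show ?case using Suc by simp
    qed (simp add: w0)
    have gn: "norm (g (w n)) \<le> C * norm y * (1/2) ^ n" for n
      using order_trans[OF g(2)[OF wV] mult_left_mono[OF wn]] C by (simp add: mult.assoc)
    have geo: "(\<lambda>n. C * norm y * (1/2::real) ^ n) sums (C * norm y * 2)"
      using sums_mult[OF geometric_sums[of "1/2::real"], of "C * norm y"] by simp
    have sn: "summable (\<lambda>n. norm (g (w n)))"
      using gn geo by (intro summable_comparison_test[OF _ sums_summable[OF geo]]) auto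
    define x where "x = (\<Sum>n. g (w n))"
    have gx: "(\<lambda>n. g (w n)) sums x"
      unfolding x_def using summable_norm_cancel[OF sn] by (rule summable_sums)
    have "x \<in> U"
      using gx unfolding sums_def
      by (rule closed_sequentially[OF U(2), rotated]) (auto intro!: subspace_sum[OF U(1)] g(1) wV)
    moreover have "norm x \<le> 2 * C * norm y"
    proof -
      have "norm x \<le> (\<Sum>n. norm (g (w n)))"
        unfolding x_def by (rule summable_norm[OF sn])
      also have "\<dots> \<le> C * norm y * 2"
        using gn sn geo by (metis sums_unique suminf_le sums_summable)
      finally show ?thesis by simp
    qed
    moreover have "f x = y"
    proof -
      have "(\<lambda>n. f (g (w n))) sums f x"
        using bounded_linear.sums[OF f gx] .
      moreover have "w \<longlonglongrightarrow> 0"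
        using wn by (intro Lim_null_comparison[of w "\<lambda>n. norm y * (1/2) ^ n"])
          (auto intro!: tendsto_mult_right_zero LIMSEQ_power_zero)
      then have "(\<lambda>n. w n - w (Suc n)) sums (w 0 - 0)"
        by (rule telescope_sums')
      ultimately show ?thesis
        by (simp add: wS w0 sums_unique2)
    qed
    ultimately show ?thesis by blast
  qed
  then show ?thesis
    using C by (intro exI[of _ "2 * C"]) auto
qed

section \<open>Shifted operators and quasinilpotence\<close>

interpretation cvec: vector_space "scaleC :: complex \<Rightarrow> 'a::complex_banach \<Rightarrow> 'a"
  by (rule vector_space_scaleC)

lemma real_subspace_if_complex_subspace:
  "cvec.subspace M \<Longrightarrow> subspace M"
  by (auto simp: cvec.subspace_def subspace_def simp flip: scaleC_of_real)

lemma bounded_clinear_shift_op: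
  assumes "bounded_clinear T"
  shows "bounded_clinear (shift_op T c)"
proof -
  have T: "bounded_linear T" "\<And>c x. T (c *\<^sub>C x) = c *\<^sub>C T x"
    using assms by (auto simp: bounded_clinear_def)
  have "bounded_linear ((*\<^sub>C) c :: 'a \<Rightarrow> 'a)"
    by (rule bounded_linear_intro[of _ "cmod c"])
      (auto simp: scaleC_add_right norm_scaleC scaleC_scaleC mult.commute simp flip: scaleC_of_real)
  then have "bounded_linear (shift_op T c)"
    unfolding shift_op_def by (intro bounded_linear_sub T(1))
  then show ?thesis
    by (auto simp: bounded_clinear_def shift_op_def T(2) cvec.scale_right_diff_distrib scaleC_scaleC mult.commute)
qed

lemma bounded_linear_funpow:
  fixes S :: "'a::real_normed_vector \<Rightarrow> 'a"
  assumes "bounded_linear S"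
  shows "bounded_linear (S ^^ n)"
proof (induction n)
  case 0
  then show ?case by (simp add: id_def bounded_linear_ident)
next
  case (Suc n)
  then show ?case
    using bounded_linear_compose[OF assms Suc] by (simp add: o_def)
qed

lemma norm_le_onorm_on:
  assumes A: "bounded_linear A" and x: "x \<in> N"
  shows "norm (A x) \<le> onorm_on N A * norm x"
proof (cases "x = 0")
  case True
  then show ?thesis
    using A by (simp add: bounded_linear.linear linear_0)
next
  case False
  have "bdd_above ((\<lambda>x. norm (A x) / norm x) ` N)"
    by (intro bdd_aboveI2[of _ _ "onorm A"] le_onorm A)
  then have "norm (A x) / norm x \<le> onorm_on N A"
    unfolding onorm_on_def using x by (intro cSUP_upper)
  then show ?thesis
    using False by (simp add: field_simps)
qed

lemma onorm_on_nonneg: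
  assumes "bounded_linear A" "0 \<in> N"
  shows "0 \<le> onorm_on N A"
proof -
  have "bdd_above ((\<lambda>x. norm (A x) / norm x) ` N)"
    by (intro bdd_aboveI2[of _ _ "onorm A"] le_onorm assms)
  then show ?thesis
    unfolding onorm_on_def using assms(2) by (intro cSUP_upper2[of _ _ 0]) auto
qed

lemma onorm_on_le:
  assumes "0 \<in> N" "0 \<le> B" "\<And>x. x \<in> N \<Longrightarrow> norm (A x) \<le> B * norm x"
  shows "onorm_on N A \<le> B"
  unfolding onorm_on_def
proof (rule cSUP_least)
  show "norm (A x) / norm x \<le> B" if "x \<in> N" for x
    using assms(2) assms(3)[OF that] by (cases "x = 0") (auto simp: field_simps)
qed (use assms(1) in blast)

text \<open>This turns the Gelfand-type limits in the definitions into geometric bounds.\<close>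
lemma root_less_imp_le_power:
  assumes "n > 0" "root n a < e" "0 \<le> a"
  shows "a \<le> e ^ n"
  using assms by (metis less_imp_le power_mono real_root_ge_zero real_root_pow_pos2)

text \<open>For each \<open>e > 0\<close> the operators \<open>S\<^sup>n / e\<^sup>n\<close> are bounded at every point of \<open>N\<close>, hence uniformly bounded
  on \<open>N\<close>; so the spectral radius of the restriction is at most \<open>e\<close>.\<close>
lemma quasinilpotent_on_if_subset_quasinilpotent_part:
  fixes S :: "'a::complex_banach \<Rightarrow> 'a"
  assumes N: "subspace N" "closed N" and S: "bounded_linear S"
    and sub: "N \<subseteq> quasinilpotent_part S"
  shows "quasinilpotent_on N S"
proof -
  have lin: "bounded_linear (S ^^ n)" for n
    using S by (rule bounded_linear_funpow)
  have N0: "0 \<in> N"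
    using N(1) by (rule subspace_0)
  have bound: "\<exists>B>0. \<forall>n. onorm_on N (S ^^ n) \<le> B * e ^ n" if e: "e > 0" for e
  proof -
    have "\<exists>B. \<forall>n. norm ((1 / e ^ n) *\<^sub>R (S ^^ n) x) \<le> B" if x: "x \<in> N" for x
    proof -
      have "(\<lambda>n. root n (norm ((S ^^ n) x))) \<longlonglongrightarrow> 0"
        using sub x by (auto simp: quasinilpotent_part_def)
      then have "\<forall>\<^sub>F n in sequentially. root n (norm ((S ^^ n) x)) < e"
        using e by (rule order_tendstoD)
      then obtain m where m: "\<And>n. n \<ge> m \<Longrightarrow> root n (norm ((S ^^ n) x)) < e"
        by (auto simp: eventually_sequentially)
      define a where "a = (\<lambda>n. norm ((1 / e ^ n) *\<^sub>R (S ^^ n) x))"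
      have "a n \<le> 1 + sum a {..m}" for n
      proof (cases "n \<le> m")
        case True
        have "a n \<le> sum a {..m}"
          using True by (intro member_le_sum) (auto simp: a_def)
        then show ?thesis by simp
      next
        case False
        then have "norm ((S ^^ n) x) \<le> e ^ n"
          using m[of n] by (intro root_less_imp_le_power) auto
        then have "a n \<le> 1"
          using e by (simp add: a_def divide_simps)
        moreover have "0 \<le> sum a {..m}"
          by (intro sum_nonneg) (auto simp: a_def)
        ultimately show ?thesis by simp
      qed
      then show ?thesis unfolding a_def by blast
    qed
    then obtain B where B: "B > 0" "\<And>x n. x \<in> N \<Longrightarrow> norm ((1 / e ^ n) *\<^sub>R (S ^^ n) x) \<le> B * norm x"
      using uniform_boundedness_on[OF N, of "\<lambda>n x. (1 / e ^ n) *\<^sub>R (S ^^ n) x"]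
        bounded_linear_const_scaleR[OF lin] by blast
    have "onorm_on N (S ^^ n) \<le> B * e ^ n" for n
    proof (rule onorm_on_le[OF N0])
      show "norm ((S ^^ n) x) \<le> B * e ^ n * norm x" if "x \<in> N" for x
        using B(2)[OF that, of n] e by (simp add: divide_simps mult_ac)
    qed (use B(1) e in simp)
    then show ?thesis using B(1) by blast
  qed
  show ?thesis
    unfolding quasinilpotent_on_def
  proof (rule order_tendstoI)
    fix e :: real assume "e > 0"
    then obtain B where B: "B > 0" "\<And>n. onorm_on N (S ^^ n) \<le> B * (e / 2) ^ n"
      using bound[of "e / 2"] by auto
    have "\<forall>\<^sub>F n in sequentially. root n B < 2"
      using order_tendstoD(2)[OF LIMSEQ_root_const[OF B(1)], of 2] by simp
    with eventually_gt_at_top[of 0]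
    show "\<forall>\<^sub>F n in sequentially. root n (onorm_on N (S ^^ n)) < e"
    proof eventually_elim
      case (elim n)
      have "root n (onorm_on N (S ^^ n)) \<le> root n (B * (e / 2) ^ n)"
        using elim B(2) by simp
      also have "\<dots> = root n B * (e / 2)"
        using elim \<open>e > 0\<close> by (simp add: real_root_mult real_root_power_cancel)
      also have "\<dots> < 2 * (e / 2)"
        using elim \<open>e > 0\<close> by (intro mult_strict_right_mono) auto
      finally show ?case by simp
    qed
  next
    fix e :: real assume "e < 0"
    have "e < root n (onorm_on N (S ^^ n))" for n
    proof -
      have "0 \<le> root n (onorm_on N (S ^^ n))"
        using onorm_on_nonneg[OF lin N0, of n] by (cases "n = 0") auto
      then show ?thesis using \<open>e < 0\<close> by simp
    qed
    then show "\<forall>\<^sub>F n in sequentially. e < root n (onorm_on N (S ^^ n))"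
      by simp
  qed
qed

lemma quasinilpotent_on_imp_subset_quasinilpotent_part:
  fixes S :: "'a::complex_banach \<Rightarrow> 'a"
  assumes S: "bounded_linear S" and "quasinilpotent_on N S"
  shows "N \<subseteq> quasinilpotent_part S"
proof
  fix x assume x: "x \<in> N"
  have lin: "bounded_linear (S ^^ n)" for n
    using S by (rule bounded_linear_funpow)
  show "x \<in> quasinilpotent_part S"
  proof (cases "x = 0")
    case True
    then have "root n (norm ((S ^^ n) x)) = 0" for n
      using linear_0[OF bounded_linear.linear[OF lin[of n]]] by simp
    then show ?thesis by (simp add: quasinilpotent_part_def)
  next
    case False
    have lim: "(\<lambda>n. root n (onorm_on N (S ^^ n)) * root n (norm x)) \<longlonglongrightarrow> 0 * 1"
      using assms(2) False unfolding quasinilpotent_on_def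
      by (intro tendsto_mult LIMSEQ_root_const) auto
    have le: "norm (root n (norm ((S ^^ n) x))) \<le> root n (onorm_on N (S ^^ n)) * root n (norm x)"
      if "n > 0" for n
    proof -
      have "root n (norm ((S ^^ n) x)) \<le> root n (onorm_on N (S ^^ n) * norm x)"
        using norm_le_onorm_on[OF lin x] that by (intro real_root_le_mono)
      then show ?thesis
        using that by (simp add: real_root_mult)
    qed
    have "\<forall>\<^sub>F n in sequentially.
        norm (root n (norm ((S ^^ n) x))) \<le> root n (onorm_on N (S ^^ n)) * root n (norm x)"
      using le by (intro eventually_sequentiallyI[of 1]) simp
    then have "(\<lambda>n. root n (norm ((S ^^ n) x))) \<longlonglongrightarrow> 0"
      by (rule Lim_null_comparison) (use lim in simp)
    then show ?thesis by (simp add: quasinilpotent_part_def)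
  qed
qed

lemma funpow_backward_orbit:
  assumes "\<And>n. S (u (Suc n)) = u n"
  shows "(S ^^ n) (u n) = u 0"
  by (induction n) (simp_all add: assms funpow_swap1)

text \<open>Since \<open>w 0 = S\<^sup>n (w n)\<close>, the superexponential decay of \<open>S\<^sup>n\<close> on \<open>N\<close> beats the geometric
  growth of \<open>w\<close>.  In other words, the restriction to \<open>N\<close> has trivial analytic core.\<close>
lemma quasinilpotent_on_backward_orbit_eq_0:
  fixes S :: "'a::complex_banach \<Rightarrow> 'a"
  assumes S: "bounded_linear S" and qn: "quasinilpotent_on N S" and "0 \<in> N"
    and w: "\<And>n. w n \<in> N" "\<And>n. S (w (Suc n)) = w n"
    and bound: "\<And>n. norm (w n) \<le> B * c ^ n" and c: "c > 0"
  shows "w 0 = 0"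
proof -
  have lin: "bounded_linear (S ^^ n)" for n
    using S by (rule bounded_linear_funpow)
  have "\<forall>\<^sub>F n in sequentially. root n (onorm_on N (S ^^ n)) < 1 / (2 * c)"
    using qn c unfolding quasinilpotent_on_def by (intro order_tendstoD(2)) auto
  with eventually_gt_at_top[of 0]
  have "\<forall>\<^sub>F n in sequentially. norm (w 0) \<le> B * (1 / 2) ^ n"
  proof eventually_elim
    case (elim n)
    have "norm (w 0) \<le> onorm_on N (S ^^ n) * norm (w n)"
      using norm_le_onorm_on[OF lin w(1), of n n] funpow_backward_orbit[of S w n] w(2) by simp
    also have "\<dots> \<le> (1 / (2 * c)) ^ n * (B * c ^ n)"
      using elim root_less_imp_le_power[of n] onorm_on_nonneg[OF lin \<open>0 \<in> N\<close>] bound c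
      by (intro mult_mono) auto
    also have "\<dots> = B * (1 / 2) ^ n"
      using c by (simp add: power_divide power_mult_distrib)
    finally show ?case .
  qed
  moreover have "(\<lambda>n. B * (1 / 2 :: real) ^ n) \<longlonglongrightarrow> 0"
    by (intro tendsto_mult_right_zero LIMSEQ_power_zero) simp
  ultimately have "norm (w 0) \<le> 0"
    by (intro tendsto_lowerbound) auto
  then show ?thesis by simp
qed

section \<open>Direct sums and closed images\<close>

lemma direct_sum_decomp_unique:
  assumes "subspace M" "subspace N" "direct_sum_decomp M N"
    and "a \<in> M" "a' \<in> M" "b \<in> N" "b' \<in> N" "a + b = a' + b'"
  shows "a = a' \<and> b = b'"
proof -
  have "a - a' = b' - b"
    using assms(8) by (simp add: algebra_simps)
  moreover have "a - a' \<in> M" "b' - b \<in> N"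
    using assms by (simp_all add: subspace_diff)
  ultimately have "a - a' \<in> M \<inter> N" by simp
  then have "a - a' = 0"
    using assms(3) unfolding direct_sum_decomp_def by blast
  then show ?thesis
    using \<open>a - a' = b' - b\<close> by simp
qed

lemma direct_sum_decomp_obtain:
  assumes "direct_sum_decomp M N"
  obtains a b where "a \<in> M" "b \<in> N" "z = a + b"
proof -
  have "z \<in> {x + y |x y. x \<in> M \<and> y \<in> N}"
    using assms by (simp add: direct_sum_decomp_def)
  then show ?thesis using that by blast
qed

text \<open>The open mapping theorem for the addition map on \<open>M \<times> N\<close>.\<close>
lemma direct_sum_decomp_bounded_projections:
  fixes M N :: "'a::complex_banach set"
  assumes M: "subspace M" "closed M" and N: "subspace N" "closed N"
    and MN: "direct_sum_decomp M N"
  shows "\<exists>D>0. \<forall>a\<in>M. \<forall>b\<in>N. norm a \<le> D * norm (a + b) \<and> norm b \<le> D * norm (a + b)"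
proof -
  let ?f = "\<lambda>p::'a \<times> 'a. fst p + snd p"
  have "?f ` (M \<times> N) = UNIV"
  proof (intro equalityI subsetI)
    fix z
    obtain a b where "a \<in> M" "b \<in> N" "z = a + b"
      using MN by (rule direct_sum_decomp_obtain)
    then show "z \<in> ?f ` (M \<times> N)"
      by (intro image_eqI[of _ _ "(a, b)"]) auto
  qed simp
  moreover have "bounded_linear ?f"
    by (intro bounded_linear_add bounded_linear_fst bounded_linear_snd)
  ultimately obtain D where D: "D > 0"
    "\<And>z. \<exists>p\<in>M \<times> N. ?f p = z \<and> norm p \<le> D * norm z"
    using bounded_preimages[of "M \<times> N" ?f] subspace_Times[OF M(1) N(1)] closed_Times[OF M(2) N(2)]
    by auto
  have "norm a \<le> D * norm (a + b) \<and> norm b \<le> D * norm (a + b)" if "a \<in> M" "b \<in> N" for a b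
  proof -
    obtain p where p: "p \<in> M \<times> N" "fst p + snd p = a + b" "norm p \<le> D * norm (a + b)"
      using D(2) by blast
    then have "fst p = a \<and> snd p = b"
      using that by (intro direct_sum_decomp_unique[OF M(1) N(1) MN]) auto
    then show ?thesis
      using p(3) norm_fst_le[of "fst p" "snd p"] norm_snd_le[of "snd p" "fst p"] by auto
  qed
  then show ?thesis using D(1) by blast
qed

text \<open>The sum is the preimage of \<open>Y\<close> under the continuous projection onto \<open>M\<close> along \<open>N\<close>.\<close>
lemma closed_direct_sum_part:
  fixes M N Y :: "'a::complex_banach set"
  assumes M: "subspace M" "closed M" and N: "subspace N" "closed N"
    and MN: "direct_sum_decomp M N" and Y: "Y \<subseteq> M" "closed Y"
  shows "closed {y + b |y b. y \<in> Y \<and> b \<in> N}"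
  unfolding closed_sequential_limits
proof (intro allI impI, elim conjE)
  fix z l
  assume z: "\<forall>n. z n \<in> {y + b |y b. y \<in> Y \<and> b \<in> N}" and lim: "z \<longlonglongrightarrow> l"
  obtain D where D: "D > 0" "\<And>a b. a \<in> M \<Longrightarrow> b \<in> N \<Longrightarrow> norm a \<le> D * norm (a + b)"
    using direct_sum_decomp_bounded_projections[OF M N MN] by blast
  obtain y b where yb: "\<And>n. y n \<in> Y" "\<And>n. b n \<in> N" "\<And>n. z n = y n + b n"
    using z by (simp, metis)
  obtain a d where ad: "a \<in> M" "d \<in> N" "l = a + d"
    using MN by (rule direct_sum_decomp_obtain)
  have "norm (y n - a) \<le> D * norm (z n - l)" for n
  proof -
    have "z n - l = (y n - a) + (b n - d)"
      by (simp add: yb(3) ad(3))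
    moreover have "y n - a \<in> M" "b n - d \<in> N"
      using subsetD[OF Y(1) yb(1)[of n]] yb(2)[of n] ad(1,2) M(1) N(1) by (simp_all add: subspace_diff)
    ultimately show ?thesis using D(2) by metis
  qed
  moreover have "(\<lambda>n. D * norm (z n - l)) \<longlonglongrightarrow> 0"
    using lim by (intro tendsto_mult_right_zero tendsto_norm_zero) (simp add: LIM_zero)
  ultimately have "(\<lambda>n. y n - a) \<longlonglongrightarrow> 0"
    by (intro Lim_null_comparison[of "\<lambda>n. y n - a" "\<lambda>n. D * norm (z n - l)"]) auto
  then have "y \<longlonglongrightarrow> a"
    by (simp add: LIM_zero_iff)
  then have "a \<in> Y"
    using closed_sequentially[OF Y(2)] yb(1) by blast
  then show "l \<in> {y + b |y b. y \<in> Y \<and> b \<in> N}"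
    using ad by blast
qed

text \<open>When \<open>Y\<close> contains the kernel, \<open>Y\<close> is saturated for \<open>S\<close>, and \<open>S\<close> is open onto its
  range: if images \<open>S (y n)\<close> converge to \<open>S m\<close>, small preimages \<open>w n\<close> of the differences give
  points \<open>m + w n\<close> of \<open>Y\<close> that converge to \<open>m\<close>.\<close>
lemma closed_image_if_kernel_subset:
  fixes S :: "'a::banach \<Rightarrow> 'b::banach"
  assumes M: "subspace M" "closed M" and S: "bounded_linear S" and cl: "closed (S ` M)"
    and Y: "subspace Y" "Y \<subseteq> M" "closed Y" and ker: "\<And>x. x \<in> M \<Longrightarrow> S x = 0 \<Longrightarrow> x \<in> Y"
  shows "closed (S ` Y)"
  unfolding closed_sequential_limits
proof (intro allI impI, elim conjE)
  fix z l
  assume z: "\<forall>n. z n \<in> S ` Y" and lim: "z \<longlonglongrightarrow> l"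
  have lin: "linear S" using S by (rule bounded_linear.linear)
  obtain C where C: "C > 0" "\<And>y. y \<in> S ` M \<Longrightarrow> \<exists>x\<in>M. S x = y \<and> norm x \<le> C * norm y"
    using bounded_preimages[OF M S cl] by blast
  have "l \<in> S ` M"
    using closed_sequentially[OF cl _ lim] z Y(2) by blast
  then obtain m where m: "m \<in> M" "l = S m" by blast
  obtain y where y: "\<And>n. y n \<in> Y" "\<And>n. z n = S (y n)"
    using z unfolding image_iff by metis
  have "\<exists>w\<in>M. S w = z n - l \<and> norm w \<le> C * norm (z n - l)" for n
    using m y(1)[of n] Y(2) M(1) lin
    by (intro C(2) image_eqI[of _ _ "y n - m"]) (auto simp: y(2) linear_diff subspace_diff)
  then obtain w where w: "\<And>n. w n \<in> M" "\<And>n. S (w n) = z n - l" "\<And>n. norm (w n) \<le> C * norm (z n - l)"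
    by metis
  have "(\<lambda>n. C * norm (z n - l)) \<longlonglongrightarrow> 0"
    using lim by (intro tendsto_mult_right_zero tendsto_norm_zero) (simp add: LIM_zero)
  then have "w \<longlonglongrightarrow> 0"
    using w(3) by (intro Lim_null_comparison[of w "\<lambda>n. C * norm (z n - l)"]) auto
  then have "(\<lambda>n. m + w n) \<longlonglongrightarrow> m"
    using tendsto_add[OF tendsto_const[of m]] by fastforce
  moreover have "m + w n \<in> Y" for n
  proof -
    have "y n - m - w n \<in> M"
      using subsetD[OF Y(2) y(1)[of n]] m(1) w(1)[of n] M(1) by (simp add: subspace_diff)
    moreover have "S (y n - m - w n) = 0"
      using m(2) y(2) w(2) by (simp add: linear_diff[OF lin])
    ultimately have "y n - m - w n \<in> Y" by (rule ker)
    then have "y n - (y n - m - w n) \<in> Y"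
      by (rule subspace_diff[OF Y(1) y(1)])
    moreover have "y n - (y n - m - w n) = m + w n"
      by simp
    ultimately show ?thesis by simp
  qed
  ultimately have "m \<in> Y"
    by (rule closed_sequentially[OF Y(3), of "\<lambda>n. m + w n", rotated])
  then show "l \<in> S ` Y" using m(2) by blast
qed

section \<open>The analytic core\<close>

text \<open>The definition scales the geometric bound by \<open>norm x\<close>.  An arbitrary factor \<open>B\<close> is just as good:
  if \<open>x \<noteq> 0\<close>, it can be absorbed into the ratio for \<open>n > 0\<close>, and for \<open>n = 0\<close> the bound is an equality;
  if \<open>x = 0\<close>, the zero orbit can replace \<open>u\<close>.
  This is what makes the core closed under sums that cancel.\<close>
lemma analytic_core_memI:
  fixes S :: "'a::complex_banach \<Rightarrow> 'a"
  assumes S: "bounded_linear S"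
    and u: "u 0 = x" "\<And>n. S (u (Suc n)) = u n" and bound: "\<And>n. norm (u n) \<le> B * c ^ n"
    and c: "c > 0"
  shows "x \<in> analytic_core S"
proof (cases "x = 0")
  case True
  have "S 0 = 0"
    using S by (simp add: bounded_linear.linear linear_0)
  then show ?thesis
    unfolding analytic_core_def using True
    by (intro CollectI exI[of _ 1] conjI exI[of _ "\<lambda>_. 0"]) auto
next
  case False
  define K where "K = max 1 (B / norm x)"
  have "norm (u n) \<le> (K * c) ^ n * norm x" for n
  proof (cases "n = 0")
    case False
    have "B \<le> K * norm x"
      using \<open>x \<noteq> 0\<close> by (simp add: K_def field_simps max_def)
    also have "K \<le> K ^ n"
      using self_le_power[of K n] False by (simp add: K_def)
    finally have "B \<le> K ^ n * norm x"
      by (simp add: mult_right_mono)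
    then have "B * c ^ n \<le> K ^ n * norm x * c ^ n"
      using c by (intro mult_right_mono) auto
    then show ?thesis
      using bound[of n] by (simp add: power_mult_distrib mult_ac)
  qed (simp add: u)
  moreover have "K * c > 0"
    using c by (simp add: K_def)
  ultimately show ?thesis
    unfolding analytic_core_def using u by blast
qed

lemma analytic_core_memD:
  assumes "x \<in> analytic_core S"
  obtains c u where "c > 0" "u 0 = x" "\<And>n. S (u (Suc n)) = u n"
    "\<And>n. norm (u n) \<le> c ^ n * norm x"
  using assms unfolding analytic_core_def by blast

lemma subspace_analytic_core:
  fixes S :: "'a::complex_banach \<Rightarrow> 'a"
  assumes "bounded_clinear S"
  shows "cvec.subspace (analytic_core S)"
proof (rule cvec.subspaceI)
  have S: "bounded_linear S" and SC: "\<And>c x. S (c *\<^sub>C x) = c *\<^sub>C S x"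
    using assms by (auto simp: bounded_clinear_def)
  have lin: "linear S"
    using S by (rule bounded_linear.linear)
  show "0 \<in> analytic_core S"
    by (rule analytic_core_memI[OF S, of "\<lambda>_. 0" _ 0 1]) (use linear_0[OF lin] in auto)
  show "x + y \<in> analytic_core S" if x: "x \<in> analytic_core S" and y: "y \<in> analytic_core S" for x y
  proof -
    obtain c u where u: "c > 0" "u 0 = x" "\<And>n. S (u (Suc n)) = u n"
      "\<And>n. norm (u n) \<le> c ^ n * norm x"
      using x by (rule analytic_core_memD) blast
    obtain d v where v: "d > 0" "v 0 = y" "\<And>n. S (v (Suc n)) = v n"
      "\<And>n. norm (v n) \<le> d ^ n * norm y"
      using y by (rule analytic_core_memD) blast
    have "norm (u n + v n) \<le> (norm x + norm y) * max c d ^ n" for n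
    proof -
      have "c ^ n * norm x \<le> max c d ^ n * norm x" "d ^ n * norm y \<le> max c d ^ n * norm y"
        using u(1) v(1) by (auto intro!: mult_right_mono power_mono)
      then show ?thesis
        using norm_triangle_ineq[of "u n" "v n"] u(4)[of n] v(4)[of n] by (simp add: algebra_simps)
    qed
    then show ?thesis
      by (rule analytic_core_memI[OF S, of "\<lambda>n. u n + v n", rotated 2])
        (use u v linear_add[OF lin] in \<open>auto simp: less_max_iff_disj\<close>)
  qed
  show "a *\<^sub>C x \<in> analytic_core S" if x: "x \<in> analytic_core S" for a x
  proof -
    obtain c u where u: "c > 0" "u 0 = x" "\<And>n. S (u (Suc n)) = u n"
      "\<And>n. norm (u n) \<le> c ^ n * norm x"
      using x by (rule analytic_core_memD) blast
    have "norm (a *\<^sub>C u n) \<le> (cmod a * norm x) * c ^ n" for n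
      using mult_left_mono[OF u(4), of "cmod a" n] by (simp add: norm_scaleC mult_ac)
    then show ?thesis
      by (intro analytic_core_memI[OF S, of "\<lambda>n. a *\<^sub>C u n"]) (use u SC in auto)
  qed
qed

lemma image_analytic_core:
  fixes S :: "'a::complex_banach \<Rightarrow> 'a"
  assumes S: "bounded_linear S"
  shows "S ` analytic_core S = analytic_core S"
proof (intro equalityI subsetI)
  fix y assume "y \<in> S ` analytic_core S"
  then obtain x where x: "x \<in> analytic_core S" "y = S x" by blast
  obtain c u where u: "c > 0" "u 0 = x" "\<And>n. S (u (Suc n)) = u n"
    "\<And>n. norm (u n) \<le> c ^ n * norm x"
    using x(1) by (rule analytic_core_memD) blast
  obtain L where L: "L > 0" "\<And>x. norm (S x) \<le> norm x * L"
    using bounded_linear.pos_bounded[OF S] by blast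
  have "norm (S (u n)) \<le> (norm x * L) * c ^ n" for n
    using order_trans[OF L(2) mult_right_mono[OF u(4)]] L(1) by (simp add: mult_ac)
  then show "y \<in> analytic_core S"
    by (intro analytic_core_memI[OF S, of "\<lambda>n. S (u n)"]) (use u x in auto)
next
  fix x assume x: "x \<in> analytic_core S"
  obtain c u where u: "c > 0" "u 0 = x" "\<And>n. S (u (Suc n)) = u n"
    "\<And>n. norm (u n) \<le> c ^ n * norm x"
    using x by (rule analytic_core_memD) blast
  have "norm (u (Suc n)) \<le> (c * norm x) * c ^ n" for n
    using u(4)[of "Suc n"] by (simp add: mult_ac)
  then have "u (Suc 0) \<in> analytic_core S"
    by (intro analytic_core_memI[OF S, of "\<lambda>n. u (Suc n)"]) (use u in auto)
  then show "x \<in> S ` analytic_core S"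
    using u(2) u(3)[of 0] by (intro image_eqI[of _ _ "u (Suc 0)"]) auto
qed

text \<open>On \<open>M\<close> the operator is onto, so the open mapping theorem produces backward orbits with geometric
  bounds.  Conversely, the \<open>N\<close>-component of a backward orbit is a backward orbit of the same kind, so it
  vanishes by quasinilpotence.\<close>
lemma analytic_core_eq_if_direct_sum:
  fixes S :: "'a::complex_banach \<Rightarrow> 'a"
  assumes S: "bounded_linear S"
    and M: "subspace M" "closed M" and onto: "S ` M = M"
    and N: "subspace N" "closed N" "S ` N \<subseteq> N" and qn: "quasinilpotent_on N S"
    and MN: "direct_sum_decomp M N"
  shows "analytic_core S = M"
proof (intro equalityI subsetI)
  fix x assume "x \<in> M"
  obtain C where C: "C > 0" "\<And>y. y \<in> M \<Longrightarrow> \<exists>x\<in>M. S x = y \<and> norm x \<le> C * norm y"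
    using bounded_preimages[OF M S] M(2) unfolding onto by blast
  then obtain g where g: "\<And>y. y \<in> M \<Longrightarrow> g y \<in> M" "\<And>y. y \<in> M \<Longrightarrow> S (g y) = y"
    "\<And>y. y \<in> M \<Longrightarrow> norm (g y) \<le> C * norm y"
    by metis
  define u where "u = (\<lambda>n. (g ^^ n) x)"
  have uM: "u n \<in> M" for n
    by (induction n) (use \<open>x \<in> M\<close> g(1) in \<open>auto simp: u_def\<close>)
  have u: "norm (u n) \<le> norm x * C ^ n" for n
  proof (induction n)
    case (Suc n)
    have "norm (u (Suc n)) \<le> C * norm (u n)"
      using g(3)[OF uM[of n]] by (simp add: u_def)
    also have "\<dots> \<le> C * (norm x * C ^ n)"
      using Suc C(1) by (intro mult_left_mono) auto
    finally show ?case by (simp add: mult_ac)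
  qed (simp add: u_def)
  have "S (u (Suc n)) = u n" for n
    using g(2)[OF uM[of n]] by (simp add: u_def)
  then show "x \<in> analytic_core S"
    using u C(1) by (intro analytic_core_memI[OF S, of u]) (auto simp: u_def)
next
  have lin: "linear S"
    using S by (rule bounded_linear.linear)
  fix x assume "x \<in> analytic_core S"
  then obtain c u where c: "c > 0" and u: "u 0 = x" "\<And>n. S (u (Suc n)) = u n"
    "\<And>n. norm (u n) \<le> c ^ n * norm x"
    by (rule analytic_core_memD) blast
  have "\<exists>a b. a \<in> M \<and> b \<in> N \<and> u n = a + b" for n
    using direct_sum_decomp_obtain[OF MN, of "u n"] by metis
  then obtain v w where vw: "\<And>n. v n \<in> M" "\<And>n. w n \<in> N" "\<And>n. u n = v n + w n"
    by metis
  have Sw: "S (w (Suc n)) = w n" for n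
  proof -
    have "S (v (Suc n)) \<in> M" "S (w (Suc n)) \<in> N"
      using onto N(3) vw by blast+
    moreover have "S (v (Suc n)) + S (w (Suc n)) = v n + w n"
      using u(2)[of n] by (simp add: vw(3) linear_add[OF lin])
    ultimately show ?thesis
      using direct_sum_decomp_unique[OF M(1) N(1) MN _ vw(1)[of n] _ vw(2)[of n]] by blast
  qed
  obtain D where D: "D > 0" "\<And>a b. a \<in> M \<Longrightarrow> b \<in> N \<Longrightarrow> norm b \<le> D * norm (a + b)"
    using direct_sum_decomp_bounded_projections[OF M N(1,2) MN] by blast
  have "norm (w n) \<le> (D * norm x) * c ^ n" for n
  proof -
    have "norm (w n) \<le> D * norm (u n)"
      using D(2) vw by simp
    also have "\<dots> \<le> D * (c ^ n * norm x)"
      using u(3) D(1) by (intro mult_left_mono) auto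
    finally show ?thesis by (simp add: mult_ac)
  qed
  then have "w 0 = 0"
    by (rule quasinilpotent_on_backward_orbit_eq_0[where w = w, OF S qn subspace_0[OF N(1)] vw(2) Sw _ c])
  then show "x \<in> M"
    using u(1) vw(1)[of 0] vw(3)[of 0] by simp
qed

section \<open>Supercyclicity against Jordan blocks\<close>

text \<open>The coefficient of \<open>x\<close> is a continuous functional on \<open>span {x} + V\<close>; \<open>d\<close> is a lower bound for the
  distance from \<open>x\<close> to \<open>V\<close>.\<close>
lemma coefficient_bound_off_closed_subspace:
  fixes V :: "'a::complex_banach set"
  assumes V: "cvec.subspace V" "closed V" and x: "x \<notin> V"
  shows "\<exists>d>0. \<forall>p. \<forall>v\<in>V. d * cmod p \<le> norm (p *\<^sub>C x + v)"
proof -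
  have "open (- V)" "x \<in> - V"
    using V(2) x by auto
  then obtain d where d: "d > 0" "ball x d \<subseteq> - V"
    unfolding open_contains_ball by blast
  have "d * cmod p \<le> norm (p *\<^sub>C x + v)" if v: "v \<in> V" for p v
  proof (cases "p = 0")
    case False
    have "- (inverse p *\<^sub>C v) \<in> V"
      using V(1) v by (intro cvec.subspace_neg cvec.subspace_scale)
    then have "- (inverse p *\<^sub>C v) \<notin> ball x d"
      using d(2) by blast
    then have "d \<le> norm (x + inverse p *\<^sub>C v)"
      by (simp add: dist_norm)
    then have "cmod p * d \<le> norm (p *\<^sub>C (x + inverse p *\<^sub>C v))"
      by (simp add: norm_scaleC mult_left_mono)
    also have "p *\<^sub>C (x + inverse p *\<^sub>C v) = p *\<^sub>C x + v"
      using False by (simp add: scaleC_add_right)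
    finally show ?thesis by (simp add: mult.commute)
  qed simp
  then show ?thesis using d(1) by blast
qed

text \<open>Modulo \<open>W\<close>, the operator \<open>T - c\<close> sends \<open>x\<close> to \<open>(T - c) x\<close> and the latter to zero, so this is the usual
  formula for the powers of a Jordan block of size two.\<close>
lemma funpow_modulo_jordan_flag:
  fixes T :: "'a::complex_banach \<Rightarrow> 'a"
  assumes T: "bounded_clinear T" and W: "cvec.subspace W"
    and VW: "\<And>v. v \<in> V \<Longrightarrow> shift_op T c v \<in> W" and "W \<subseteq> V"
    and x: "shift_op T c x \<in> V"
  shows "\<exists>w\<in>W. (T ^^ k) x = c ^ k *\<^sub>C x + (of_nat k * c ^ (k - 1)) *\<^sub>C shift_op T c x + w"
proof (induction k)
  case 0
  then show ?case
    using cvec.subspace_0[OF W] by (intro bexI[of _ 0]) auto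
next
  case (Suc k)
  let ?S = "shift_op T c"
  let ?q = "of_nat k * c ^ (k - 1)"
  have lin: "linear T" and TC: "\<And>a y. T (a *\<^sub>C y) = a *\<^sub>C T y"
    using T by (auto simp: bounded_clinear_def bounded_linear.linear)
  have T_eq: "T y = c *\<^sub>C y + ?S y" for y
    by (simp add: shift_op_def)
  obtain w where w: "w \<in> W" "(T ^^ k) x = c ^ k *\<^sub>C x + ?q *\<^sub>C ?S x + w"
    using Suc by blast
  have qc: "?q * c = of_nat k * c ^ k"
    by (cases k) auto
  have "(T ^^ Suc k) x = c ^ k *\<^sub>C T x + ?q *\<^sub>C T (?S x) + T w"
    by (simp add: w(2) linear_add[OF lin] TC)
  also have "\<dots> = c ^ Suc k *\<^sub>C x + (c ^ k + ?q * c) *\<^sub>C ?S x + (?q *\<^sub>C ?S (?S x) + T w)"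
    by (simp add: T_eq[of x] T_eq[of "?S x"] scaleC_add_right scaleC_add_left mult_ac)
  also have "c ^ k + ?q * c = of_nat (Suc k) * c ^ (Suc k - 1)"
    unfolding qc by (simp add: algebra_simps)
  finally have "(T ^^ Suc k) x = c ^ Suc k *\<^sub>C x + (of_nat (Suc k) * c ^ (Suc k - 1)) *\<^sub>C ?S x
      + (?q *\<^sub>C ?S (?S x) + T w)" .
  moreover have "?q *\<^sub>C ?S (?S x) + T w \<in> W"
    unfolding T_eq[of w] using VW x w(1) \<open>W \<subseteq> V\<close>
    by (intro cvec.subspace_add[OF W] cvec.subspace_scale[OF W]) auto
  ultimately show ?case by blast
qed

text \<open>A supercyclic operator has no quotient that is a Jordan block of size two.  If \<open>x\<close> were supercyclic with
  \<open>(T - c) x \<notin> W\<close>, then the multiples of the orbit have, modulo \<open>W\<close>, coordinates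
  \<open>a (c\<^sup>k, k c\<^sup>k\<^sup>-\<^sup>1)\<close> with respect to \<open>x\<close> and \<open>(T - c) x\<close>.
  For \<open>c \<noteq> 0\<close> their slopes are the numbers \<open>k / c\<close> with \<open>k \<ge> 0\<close>, which stay away from \<open>-1 / c\<close>;
  for \<open>c = 0\<close> they lie on the two coordinate axes, away from \<open>(1, 1)\<close>.
  That \<open>x \<notin> V\<close> is due to \<open>V\<close> being a proper closed subspace that \<open>T\<close> leaves invariant.\<close>
lemma supercyclic_vector_modulo_jordan_flag:
  fixes T :: "'a::complex_banach \<Rightarrow> 'a"
  assumes T: "bounded_clinear T"
    and dense: "closure {a *\<^sub>C (T ^^ n) x |a n. True} = UNIV"
    and V: "cvec.subspace V" "closed V" "V \<noteq> UNIV" and W: "cvec.subspace W" "closed W" "W \<subseteq> V"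
    and SV: "range (shift_op T c) \<subseteq> V" and SW: "shift_op T c ` V \<subseteq> W"
  shows "x \<notin> V" "shift_op T c x \<in> W"
proof -
  let ?S = "shift_op T c"
  have TC: "\<And>a y. T (a *\<^sub>C y) = a *\<^sub>C T y"
    using T by (auto simp: bounded_clinear_def)
  show xV: "x \<notin> V"
  proof
    assume "x \<in> V"
    have "(T ^^ n) x \<in> V" for n
    proof (induction n)
      case (Suc n)
      have "T ((T ^^ n) x) = c *\<^sub>C (T ^^ n) x + ?S ((T ^^ n) x)"
        by (simp add: shift_op_def)
      also have "\<dots> \<in> V"
        using Suc SV by (intro cvec.subspace_add[OF V(1)] cvec.subspace_scale[OF V(1)]) auto
      finally show ?case by simp
    qed (use \<open>x \<in> V\<close> in simp)
    then have "closure {a *\<^sub>C (T ^^ n) x |a n. True} \<subseteq> V"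
      using V(2) by (intro closure_minimal) (auto intro: cvec.subspace_scale[OF V(1)])
    then show False
      using dense V(3) by blast
  qed
  show "?S x \<in> W"
  proof (rule ccontr)
    assume SxW: "?S x \<notin> W"
    obtain d where d: "d > 0" "\<And>p v. v \<in> V \<Longrightarrow> d * cmod p \<le> norm (p *\<^sub>C x + v)"
      using coefficient_bound_off_closed_subspace[OF V(1,2) xV] by blast
    obtain d' where d': "d' > 0" "\<And>q w. w \<in> W \<Longrightarrow> d' * cmod q \<le> norm (q *\<^sub>C ?S x + w)"
      using coefficient_bound_off_closed_subspace[OF W(1,2) SxW] by blast
    \<comment> \<open>\<open>b\<close> is the slope of the vector that the multiples of the orbit cannot approach, and \<open>e\<close>
      is small enough to force \<open>cmod p < 1 / 2\<close> and \<open>cmod q < cmod b\<close> for the coordinates \<open>p\<close>, \<open>q\<close>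
      of the error.\<close>
    define b where "b = (if c = 0 then 1 else - inverse c)"
    have b: "cmod b > 0"
      by (simp add: b_def)
    define e where "e = min (d / 2) (d' * cmod b / (1 + norm x / d))"
    have pos: "1 + norm x / d > 0"
      using d(1) by (simp add: add_pos_nonneg)
    have "e > 0"
      using d(1) d'(1) b pos by (simp add: e_def)
    then obtain a k where ak: "dist (a *\<^sub>C (T ^^ k) x) (x + b *\<^sub>C ?S x) < e"
      using dense closure_approachable[of "x + b *\<^sub>C ?S x" "{a *\<^sub>C (T ^^ n) x |a n. True}"] by auto
    obtain w where w: "w \<in> W" "(T ^^ k) x = c ^ k *\<^sub>C x + (of_nat k * c ^ (k - 1)) *\<^sub>C ?S x + w"
      using funpow_modulo_jordan_flag[OF T W(1) _ W(3), of c x k] SV SW by blast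
    define p where "p = 1 - a * c ^ k"
    define q where "q = b - a * (of_nat k * c ^ (k - 1))"
    define z where "z = x + b *\<^sub>C ?S x - a *\<^sub>C (T ^^ k) x"
    have z: "z = p *\<^sub>C x + (q *\<^sub>C ?S x + - (a *\<^sub>C w))"
      unfolding z_def p_def q_def w(2)
      by (simp add: scaleC_add_right cvec.scale_left_diff_distrib)
    have ze: "norm z < e"
      using ak by (simp add: z_def dist_norm norm_minus_commute)
    have aw: "- (a *\<^sub>C w) \<in> W"
      using w(1) by (intro cvec.subspace_neg[OF W(1)] cvec.subspace_scale[OF W(1)])
    have "q *\<^sub>C ?S x + - (a *\<^sub>C w) \<in> V"
      using aw SV W(3) by (intro cvec.subspace_add[OF V(1)] cvec.subspace_scale[OF V(1)]) auto
    then have "d * cmod p \<le> norm z"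
      unfolding z by (rule d(2))
    with ze have dp: "d * cmod p < e" by simp
    also have "e \<le> d * (1 / 2)"
      using min.cobounded1[of "d / 2"] unfolding e_def by simp
    finally have p: "cmod p < 1 / 2"
      using d(1) by (simp only: mult_less_cancel_left_pos)
    have "q *\<^sub>C ?S x + - (a *\<^sub>C w) = z - p *\<^sub>C x"
      by (simp add: z)
    then have "d' * cmod q \<le> norm (z - p *\<^sub>C x)"
      using d'(2)[OF aw, of q] by simp
    also have "\<dots> \<le> norm z + cmod p * norm x"
      using norm_triangle_ineq4[of z "p *\<^sub>C x"] by (simp add: norm_scaleC)
    also have "\<dots> < e + (e / d) * norm x"
      using ze dp d(1) by (intro add_less_le_mono mult_right_mono) (auto simp: field_simps)
    also have "\<dots> = e * (1 + norm x / d)"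
      by (simp add: algebra_simps)
    also have "\<dots> \<le> d' * cmod b"
      unfolding pos_le_divide_eq[OF pos, symmetric] e_def by (rule min.cobounded2)
    finally have "cmod q < cmod b"
      using d'(1) by simp
    moreover have "cmod b \<le> cmod q"
    proof (cases "k = 0")
      case True
      then show ?thesis by (simp add: q_def)
    next
      case False
      \<comment> \<open>If \<open>c = 0\<close>, then \<open>p = 1\<close>.\<close>
      have "c \<noteq> 0"
        using p False by (auto simp: p_def power_0_left)
      have "c ^ k = c * c ^ (k - 1)"
        using False by (simp add: power_eq_if)
      then have "c * q = - (1 + of_nat k * (1 - p))"
        using \<open>c \<noteq> 0\<close> by (simp add: q_def p_def b_def algebra_simps)
      moreover have "1 \<le> Re (1 + of_nat k * (1 - p))"
        using p abs_Re_le_cmod[of p] by simp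
      then have "1 \<le> cmod (1 + of_nat k * (1 - p))"
        using complex_Re_le_cmod order_trans by blast
      ultimately have "1 \<le> cmod c * cmod q"
        by (metis norm_minus_cancel norm_mult)
      then show ?thesis
        using \<open>c \<noteq> 0\<close> by (simp add: b_def norm_inverse norm_divide field_simps)
    qed
    ultimately show False by simp
  qed
qed

lemma csubspace_image:
  assumes "bounded_clinear S" "cvec.subspace M"
  shows "cvec.subspace (S ` M)"
proof -
  have lin: "linear S" and SC: "\<And>a y. S (a *\<^sub>C y) = a *\<^sub>C S y"
    using assms(1) by (auto simp: bounded_clinear_def bounded_linear.linear)
  show ?thesis
  proof (rule cvec.subspaceI)
    show "0 \<in> S ` M"
      using linear_0[OF lin] cvec.subspace_0[OF assms(2)] by force
    show "x + y \<in> S ` M" if xy: "x \<in> S ` M" "y \<in> S ` M" for x y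
    proof -
      obtain m m' where "m \<in> M" "m' \<in> M" "x = S m" "y = S m'"
        using xy by blast
      then show ?thesis
        using cvec.subspace_add[OF assms(2)]
        by (intro image_eqI[of _ _ "m + m'"]) (auto simp: linear_add[OF lin])
    qed
    show "a *\<^sub>C x \<in> S ` M" if x: "x \<in> S ` M" for a x
    proof -
      obtain m where "m \<in> M" "x = S m"
        using x by blast
      then show ?thesis
        using cvec.subspace_scale[OF assms(2)]
        by (intro image_eqI[of _ _ "a *\<^sub>C m"]) (auto simp: SC)
    qed
  qed
qed

text \<open>The heart of the proof.  If the restriction \<open>S\<close> of \<open>T - c\<close> to \<open>M\<close> were not onto, then \<open>S M + N\<close> would be a
  proper closed subspace and \<open>S\<^sup>2 M + N\<close> a closed subspace of it, so that
  \<open>supercyclic_vector_modulo_jordan_flag\<close> places \<open>(T - c) x\<close> in \<open>S\<^sup>2 M + N\<close> for a supercyclic vector \<open>x = m + b\<close>.  Then \<open>S m = S\<^sup>2 m'\<close>, and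
  semi-regularity puts \<open>m - S m'\<close>, a vector of the kernel, into \<open>S M\<close>.  So \<open>m \<in> S M\<close>, which contradicts
  \<open>x \<notin> S M + N\<close>.  Semi-regularity is also the reason why \<open>S\<^sup>2 M\<close> is closed.\<close>
lemma semi_regular_summand_onto_if_supercyclic:
  fixes T :: "'a::complex_banach \<Rightarrow> 'a"
  assumes T: "bounded_clinear T" and "supercyclic T"
    and Minv: "closed_invariant_subspace (shift_op T c) M"
    and Ninv: "closed_invariant_subspace (shift_op T c) N"
    and MN: "direct_sum_decomp M N" and sr: "semi_regular_on M (shift_op T c)"
  shows "shift_op T c ` M = M"
proof (rule ccontr)
  let ?S = "shift_op T c"
  let ?V = "{y + b |y b. y \<in> ?S ` M \<and> b \<in> N}"
  let ?W = "{y + b |y b. y \<in> ?S ` ?S ` M \<and> b \<in> N}"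
  assume neq: "?S ` M \<noteq> M"
  have bS: "bounded_clinear ?S"
    using T by (rule bounded_clinear_shift_op)
  then have S: "bounded_linear ?S"
    by (simp add: bounded_clinear_def)
  then have lin: "linear ?S"
    by (rule bounded_linear.linear)
  have cM: "cvec.subspace M" and M: "subspace M" "closed M" and SM: "?S ` M \<subseteq> M"
    using Minv by (auto simp: closed_invariant_subspace_def real_subspace_if_complex_subspace)
  have cN: "cvec.subspace N" and N: "subspace N" "closed N" and SN: "?S ` N \<subseteq> N"
    using Ninv by (auto simp: closed_invariant_subspace_def real_subspace_if_complex_subspace)
  have clSM: "closed (?S ` M)" and ker: "\<And>y. y \<in> M \<Longrightarrow> ?S y = 0 \<Longrightarrow> y \<in> ?S ` M"
  proof -
    show "closed (?S ` M)"
      using sr by (simp add: semi_regular_on_def)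
    fix y assume "y \<in> M" "?S y = 0"
    then have "y \<in> (\<Inter>n. (?S ^^ n) ` M)"
      using sr by (auto simp: semi_regular_on_def null_space_on_def hyper_range_on_def)
    then have "y \<in> (?S ^^ 1) ` M"
      by (rule INT_D) simp
    then show "y \<in> ?S ` M"
      by (simp del: image_iff)
  qed
  have cSM: "cvec.subspace (?S ` M)"
    using bS cM by (rule csubspace_image)
  with bS have cSSM: "cvec.subspace (?S ` ?S ` M)"
    by (rule csubspace_image)
  have "closed (?S ` ?S ` M)"
    using M S clSM real_subspace_if_complex_subspace[OF cSM] SM clSM ker
    by (rule closed_image_if_kernel_subset)
  then have clW: "closed ?W"
    using SM by (intro closed_direct_sum_part[OF M N MN]) auto
  have clV: "closed ?V"
    by (rule closed_direct_sum_part[OF M N MN SM clSM])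
  have subV: "cvec.subspace ?V" and subW: "cvec.subspace ?W"
    using cvec.subspace_sums[OF cSM cN] cvec.subspace_sums[OF cSSM cN] by auto
  have SX: "range ?S \<subseteq> ?V"
  proof clarify
    fix z
    obtain m b where "m \<in> M" "b \<in> N" "z = m + b"
      using MN by (rule direct_sum_decomp_obtain)
    then show "\<exists>y b. ?S z = y + b \<and> y \<in> ?S ` M \<and> b \<in> N"
      using SN linear_add[OF lin, of m b] by blast
  qed
  have SV: "?S ` ?V \<subseteq> ?W"
  proof clarify
    fix m b assume "m \<in> M" "b \<in> N"
    then show "\<exists>y d. ?S (?S m + b) = y + d \<and> y \<in> ?S ` ?S ` M \<and> d \<in> N"
      using SN linear_add[OF lin, of "?S m" b] by blast
  qed
  have WV: "?W \<subseteq> ?V"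
    using SM by blast
  have V_UNIV: "?V \<noteq> UNIV"
  proof
    assume UN: "?V = UNIV"
    have "m \<in> ?S ` M" if m: "m \<in> M" for m
    proof -
      have "m \<in> ?V" using UN by blast
      then obtain y b where yb: "m = y + b" "y \<in> ?S ` M" "b \<in> N" by blast
      then have "m = y"
        using direct_sum_decomp_unique[OF M(1) N(1) MN m _ subspace_0[OF N(1)], of y b] SM by auto
      then show ?thesis using yb by simp
    qed
    then show False using neq SM by blast
  qed
  obtain x where dense: "closure {a *\<^sub>C (T ^^ n) x |a n. True} = UNIV"
    using \<open>supercyclic T\<close> unfolding supercyclic_def by blast
  have xV: "x \<notin> ?V" and SxW: "?S x \<in> ?W"
    using supercyclic_vector_modulo_jordan_flag[OF T dense subV clV V_UNIV subW clW WV SX SV] by auto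
  obtain m b where mb: "m \<in> M" "b \<in> N" "x = m + b"
    using MN by (rule direct_sum_decomp_obtain)
  obtain m' b' where mb': "m' \<in> M" "b' \<in> N" "?S x = ?S (?S m') + b'"
    using SxW by blast
  have "?S m + ?S b = ?S (?S m') + b'"
    using mb(3) mb'(3) by (simp add: linear_add[OF lin])
  then have "?S m = ?S (?S m')"
    using direct_sum_decomp_unique[OF M(1) N(1) MN, of "?S m" "?S (?S m')" "?S b" b'] mb mb' SM SN
    by blast
  then have "?S (m - ?S m') = 0"
    by (simp add: linear_diff[OF lin])
  moreover have "?S m' \<in> M"
    using SM mb' by blast
  then have "m - ?S m' \<in> M"
    using mb(1) M(1) by (simp add: subspace_diff)
  ultimately have "m - ?S m' \<in> ?S ` M"
    using ker by blast
  then have "(m - ?S m') + ?S m' \<in> ?S ` M"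
    using mb'(1) by (intro cvec.subspace_add[OF cSM]) auto
  then have "m \<in> ?S ` M" by simp
  then show False
    using xV mb by blast
qed

section \<open>Comparison of the two spectra\<close>

text \<open>\<open>S\<close> maps its analytic core onto itself, so the core can serve as the semi-regular summand.\<close>
lemma pseudo_Fredholm_if_right_gen_Drazin_invertible:
  fixes S :: "'a::complex_banach \<Rightarrow> 'a"
  assumes bS: "bounded_clinear S" and rgD: "right_gen_Drazin_invertible S"
  shows "pseudo_Fredholm S"
proof -
  have S: "bounded_linear S"
    using bS by (simp add: bounded_clinear_def)
  let ?K = "analytic_core S"
  obtain N where K: "closed ?K" and N: "closed_invariant_subspace S N"
    "direct_sum_decomp ?K N" "N \<subseteq> quasinilpotent_part S"
    using rgD by (auto simp: right_gen_Drazin_invertible_def)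
  have onto: "S ` ?K = ?K"
    using S by (rule image_analytic_core)
  have "(S ^^ n) ` ?K = ?K" for n
  proof (induction n)
    case (Suc n)
    have "(S ^^ Suc n) ` ?K = S ` ((S ^^ n) ` ?K)"
      by (simp only: funpow.simps image_comp)
    then show ?case
      by (simp only: Suc onto)
  qed simp
  then have "semi_regular_on ?K S"
    using K onto by (auto simp: semi_regular_on_def null_space_on_def hyper_range_on_def)
  moreover have "closed_invariant_subspace S ?K"
    using K onto subspace_analytic_core[OF bS] by (simp add: closed_invariant_subspace_def)
  moreover have "quasinilpotent_on N S"
    using N S by (intro quasinilpotent_on_if_subset_quasinilpotent_part)
      (auto simp: closed_invariant_subspace_def real_subspace_if_complex_subspace)
  ultimately show ?thesis
    unfolding pseudo_Fredholm_def using N by blast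
qed

lemma right_gen_Drazin_invertible_if_pseudo_Fredholm:
  fixes T :: "'a::complex_banach \<Rightarrow> 'a"
  assumes T: "bounded_clinear T" "supercyclic T" and pF: "pseudo_Fredholm (shift_op T c)"
  shows "right_gen_Drazin_invertible (shift_op T c)"
proof -
  let ?S = "shift_op T c"
  have S: "bounded_linear ?S"
    using bounded_clinear_shift_op[OF T(1)] by (simp add: bounded_clinear_def)
  obtain M N where M: "closed_invariant_subspace ?S M" and N: "closed_invariant_subspace ?S N"
    and MN: "direct_sum_decomp M N" and sr: "semi_regular_on M ?S" and qn: "quasinilpotent_on N ?S"
    using pF by (auto simp: pseudo_Fredholm_def)
  have "?S ` M = M"
    by (rule semi_regular_summand_onto_if_supercyclic[OF T M N MN sr])
  then have "analytic_core ?S = M"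
    using M N by (intro analytic_core_eq_if_direct_sum[OF S _ _ _ _ _ _ qn MN])
      (auto simp: closed_invariant_subspace_def real_subspace_if_complex_subspace)
  moreover have "N \<subseteq> quasinilpotent_part ?S"
    using S qn by (rule quasinilpotent_on_imp_subset_quasinilpotent_part)
  ultimately show ?thesis
    unfolding right_gen_Drazin_invertible_def using M N MN
    by (auto simp: closed_invariant_subspace_def)
qed

theorem proposition3p1:
  fixes T :: "'a::complex_banach \<Rightarrow> 'a"
  assumes "bounded_clinear T"
    and "supercyclic T"
  shows "rgD_spectrum T = gK_spectrum T"
  using assms pseudo_Fredholm_if_right_gen_Drazin_invertible[OF bounded_clinear_shift_op[OF assms(1)]]
    right_gen_Drazin_invertible_if_pseudo_Fredholm
  by (auto simp: rgD_spectrum_def gK_spectrum_def)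

end
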